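(* Let $p$ be an odd prime. Define $\mathcal{B}_0=-\frac1p\in\mathbb{Q}_p$ and $\mathcal{B}_n=\frac{B_n}{n}\in\mathbb{Q}_p$ for $n\ge1$, where $B_n$ are the Bernoulli numbers (with $B_1=-\tfrac12$). Then $$\sum_{k=0}^{p-1}\frac{\mathcal{B}_k}{2^k}\equiv 0\pmod p,$$ i.e. this sum lies in $p\mathbb{Z}_p$.
   Context: $\mathbb{Q}_p$ denotes the field of $p$-adic numbers and $\mathbb{Z}_p$ its ring of integers. *)

theory Defs
  imports
    Complex_Main
    "HOL-Algebra.QuotRing"
    "HOL-Computational_Algebra.Primes"
    "HOL-Computational_Algebra.Formal_Power_Series"
begin

(* Bernoulli numbers, from the exponential generating function t / (e^t - 1);
   this is the convention with B_1 = -1/2. *)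

definition bernoulli :: "nat \<Rightarrow> rat" where
  "bernoulli n = fact n * fps_nth (fps_X / (fps_exp 1 - 1)) n"

lemma fps_X_eq_bernoulli: "(fps_X / (fps_exp 1 - 1)) * (fps_exp 1 - 1) = (fps_X :: rat fps)"
proof -
  have s: "subdegree (fps_exp 1 - 1 :: rat fps) = 1"
    by (rule subdegreeI) auto
  then have nz: "(fps_exp 1 - 1 :: rat fps) \<noteq> 0" by auto
  have "(fps_exp 1 - 1 :: rat fps) dvd fps_X"
    using s nz by (simp add: fps_dvd_iff)
  then show ?thesis by simp
qed

lemma bernoulli_recurrence:
  "(\<Sum>k\<le>n. of_nat (Suc n choose k) * bernoulli k) = (if n = 0 then 1 else 0)"
proof -
  let ?b = "fps_X / (fps_exp 1 - 1) :: rat fps"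
  have "(if n = 0 then 1 else 0) = fact (Suc n) * fps_nth (?b * (fps_exp 1 - 1)) (Suc n)"
    unfolding fps_X_eq_bernoulli by (simp add: fps_X_def)
  also have "fps_nth (?b * (fps_exp 1 - 1)) (Suc n)
      = (\<Sum>k=0..Suc n. fps_nth ?b k * fps_nth (fps_exp 1 - 1) (Suc n - k))"
    by (rule fps_mult_nth)
  also have "\<dots> = (\<Sum>k\<le>n. fps_nth ?b k / fact (Suc n - k))"
    by (auto simp: atMost_atLeast0 intro!: sum.cong)
  also have "fact (Suc n) * \<dots> = (\<Sum>k\<le>n. of_nat (Suc n choose k) * bernoulli k)"
    unfolding sum_distrib_left
    by (intro sum.cong refl) (simp add: bernoulli_def binomial_fact del: fact_Suc)
  finally show ?thesis by simp
qed

lemma bernoulli_0: "bernoulli 0 = 1"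
  using bernoulli_recurrence[of 0] by simp

lemma bernoulli_1: "bernoulli 1 = - 1 / 2"
  using bernoulli_recurrence[of 1] bernoulli_0 by simp


(* The p-adic valuation and absolute value on the rationals.
   The value of padic_val at 0 is irrelevant. *)

definition padic_val :: "nat \<Rightarrow> rat \<Rightarrow> int" where
  "padic_val p x = int (multiplicity (int p) (fst (quotient_of x)))
                 - int (multiplicity (int p) (snd (quotient_of x)))"

definition padic_abs :: "nat \<Rightarrow> rat \<Rightarrow> real" where
  "padic_abs p x = (if x = 0 then 0 else real p powi (- padic_val p x))"

(* The field Q_p of p-adic numbers, as the completion of the rationals:
   the ring of p-adic Cauchy sequences modulo the ideal of p-adic null sequences. *)

definition padic_Cauchy :: "nat \<Rightarrow> (nat \<Rightarrow> rat) \<Rightarrow> bool" where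
  "padic_Cauchy p X \<longleftrightarrow> (\<forall>e>0. \<exists>N. \<forall>m\<ge>N. \<forall>n\<ge>N. padic_abs p (X m - X n) < e)"

definition padic_null :: "nat \<Rightarrow> (nat \<Rightarrow> rat) set" where
  "padic_null p = {X. (\<lambda>n. padic_abs p (X n)) \<longlonglongrightarrow> 0}"

definition padic_Cauchy_ring :: "nat \<Rightarrow> (nat \<Rightarrow> rat) ring" where
  "padic_Cauchy_ring p =
    \<lparr>carrier = {X. padic_Cauchy p X},
     monoid.mult = (\<lambda>X Y n. X n * Y n), one = (\<lambda>n. 1),
     zero = (\<lambda>n. 0), add = (\<lambda>X Y n. X n + Y n)\<rparr>"

definition Qp :: "nat \<Rightarrow> (nat \<Rightarrow> rat) set ring" where
  "Qp p = padic_Cauchy_ring p Quot padic_null p"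

definition Qp_of_rat :: "nat \<Rightarrow> rat \<Rightarrow> (nat \<Rightarrow> rat) set" where
  "Qp_of_rat p q = padic_null p +>\<^bsub>padic_Cauchy_ring p\<^esub> (\<lambda>n. q)"

(* The limit does not depend on the representative of the class x. *)

definition Qp_abs :: "nat \<Rightarrow> (nat \<Rightarrow> rat) set \<Rightarrow> real" where
  "Qp_abs p x = lim (\<lambda>n. padic_abs p ((SOME X. X \<in> x) n))"

definition Zp :: "nat \<Rightarrow> (nat \<Rightarrow> rat) set set" where
  "Zp p = {x \<in> carrier (Qp p). Qp_abs p x \<le> 1}"

definition p_Zp :: "nat \<Rightarrow> (nat \<Rightarrow> rat) set set" where
  "p_Zp p = {Qp_of_rat p (of_nat p) \<otimes>\<^bsub>Qp p\<^esub> z | z. z \<in> Zp p}"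

definition bernoulli_Qp :: "nat \<Rightarrow> nat \<Rightarrow> (nat \<Rightarrow> rat) set" where
  "bernoulli_Qp p n =
    Qp_of_rat p (if n = 0 then - 1 / of_nat p else bernoulli n / of_nat n)"

lemma padic_val_divide:
  fixes a b :: int
  assumes p: "prime p" and a: "a \<noteq> 0" and b: "b \<noteq> 0"
  shows "padic_val p (of_int a / of_int b)
    = int (multiplicity (int p) a) - int (multiplicity (int p) b)"
proof -
  obtain c d where q: "quotient_of (of_int a / of_int b) = (c, d)" by fastforce
  have d: "d \<noteq> 0" using quotient_of_denom_pos[OF q] by simp
  have e: "of_int a / of_int b = (of_int c / of_int d :: rat)" by (rule quotient_of_div[OF q])
  then have "of_int (a * d) = (of_int (c * b) :: rat)" using b d by (simp add: field_simps)
  then have ad: "a * d = c * b" using of_int_eq_iff by blast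
  have c: "c \<noteq> 0" using ad a d by auto
  have pe: "prime_elem (int p)" using p by auto
  have "multiplicity (int p) a + multiplicity (int p) d
      = multiplicity (int p) c + multiplicity (int p) b"
    using ad a b c d prime_elem_multiplicity_mult_distrib[OF pe] by metis
  then show ?thesis unfolding padic_val_def q by simp
qed

lemma rat_common_denom:
  obtains a b d :: int where "d \<noteq> 0" "x = (of_int a / of_int d :: rat)" "y = (of_int b / of_int d :: rat)"
proof -
  obtain a d b e where "quotient_of x = (a, d)" "quotient_of y = (b, e)" by fastforce
  then have *: "x = of_int a / of_int d" "y = of_int b / of_int e" "d \<noteq> 0" "e \<noteq> 0"
    using quotient_of_div quotient_of_denom_pos by (auto, blast+)
  show ?thesis
    by (rule that[of "d * e" "a * e" "b * d"]) (use * in auto)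
qed

lemma padic_abs_0 [simp]: "padic_abs p 0 = 0"
  by (simp add: padic_abs_def)

lemma padic_abs_1 [simp]: "padic_abs p 1 = 1"
  by (simp add: padic_abs_def padic_val_def)

lemma padic_abs_nonneg [simp]: "padic_abs p x \<ge> 0"
  by (simp add: padic_abs_def)

lemma padic_abs_eq_0_iff: "prime p \<Longrightarrow> padic_abs p x = 0 \<longleftrightarrow> x = 0"
  by (auto simp: padic_abs_def prime_gt_0_nat)

lemma padic_abs_mult:
  assumes p: "prime p"
  shows "padic_abs p (x * y) = padic_abs p x * padic_abs p y"
proof (cases "x = 0 \<or> y = 0")
  case True
  then show ?thesis by auto
next
  case False
  obtain a b d where d: "d \<noteq> 0" and x: "x = of_int a / of_int d" and y: "y = of_int b / of_int d"
    by (rule rat_common_denom)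
  have ab: "a \<noteq> 0" "b \<noteq> 0" using False x y by auto
  have xy: "x * y = of_int (a * b) / of_int (d * d)" by (simp add: x y)
  have pe: "prime_elem (int p)" using p by auto
  have "padic_val p (x * y) = padic_val p x + padic_val p y"
    unfolding xy unfolding x y using ab d p
    by (simp add: padic_val_divide prime_elem_multiplicity_mult_distrib[OF pe] del: of_int_mult)
  then show ?thesis using False p
    by (simp add: padic_abs_def power_int_add prime_gt_0_nat power_int_diff power_int_minus divide_inverse)
qed

lemma padic_abs_uminus [simp]: "padic_abs p (- x) = padic_abs p x"
proof -
  have "multiplicity (int p) (- a) = multiplicity (int p) a" for a
    using multiplicity_times_unit_right[of "-1" "int p" a] by simp
  then show ?thesis
    by (auto simp: padic_abs_def padic_val_def rat_uminus_code split: prod.splits)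
qed

lemma padic_abs_add:
  assumes p: "prime p"
  shows "padic_abs p (x + y) \<le> max (padic_abs p x) (padic_abs p y)"
proof (cases "x = 0 \<or> y = 0 \<or> x + y = 0")
  case True
  then show ?thesis by (auto simp: le_max_iff_disj)
next
  case False
  obtain a b d where d: "d \<noteq> 0" and x: "x = of_int a / of_int d" and y: "y = of_int b / of_int d"
    by (rule rat_common_denom)
  have xy: "x + y = of_int (a + b) / of_int d" by (simp add: x y add_divide_distrib)
  have nz: "a \<noteq> 0" "b \<noteq> 0" "a + b \<noteq> 0" using False unfolding xy unfolding x y by auto
  have np: "\<not> is_unit (int p)" using p by auto
  let ?k = "min (multiplicity (int p) a) (multiplicity (int p) b)"
  have "int p ^ ?k dvd a + b" by (intro dvd_add multiplicity_dvd') auto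
  then have "?k \<le> multiplicity (int p) (a + b)" using nz np by (intro multiplicity_geI) auto
  then have "padic_val p x \<le> padic_val p (x + y) \<or> padic_val p y \<le> padic_val p (x + y)"
    unfolding xy unfolding x y using nz d p by (auto simp: padic_val_divide simp del: of_int_add)
  moreover have "real p \<ge> 1" using p prime_ge_1_nat by auto
  ultimately show ?thesis using False
    by (auto simp: padic_abs_def le_max_iff_disj intro: power_int_increasing)
qed

lemma padic_abs_add_le: "prime p \<Longrightarrow> padic_abs p (x + y) \<le> padic_abs p x + padic_abs p y"
  using padic_abs_add[of p x y] padic_abs_nonneg[of p x] padic_abs_nonneg[of p y] by linarith

lemma padic_abs_diff_commute: "padic_abs p (x - y) = padic_abs p (y - x)"
  by (metis minus_diff_eq padic_abs_uminus)

lemma padic_abs_diff_ge: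
  "prime p \<Longrightarrow> \<bar>padic_abs p x - padic_abs p y\<bar> \<le> padic_abs p (x - y)"
  using padic_abs_add_le[of p "x - y" y] padic_abs_add_le[of p "y - x" x]
    padic_abs_diff_commute[of p x y] by simp

lemma padic_Cauchy_const [simp]: "padic_Cauchy p (\<lambda>n. c)"
  by (simp add: padic_Cauchy_def)

lemma padic_Cauchy_bounded:
  assumes p: "prime p" and X: "padic_Cauchy p X"
  obtains K where "K > 0" "\<And>n. padic_abs p (X n) \<le> K"
proof -
  obtain N where N: "\<forall>m\<ge>N. \<forall>n\<ge>N. padic_abs p (X m - X n) < 1"
    using X unfolding padic_Cauchy_def by (meson zero_less_one)
  let ?K = "(\<Sum>k\<le>N. padic_abs p (X k)) + 1"
  have "?K > 0" by (simp add: add_nonneg_pos sum_nonneg)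
  moreover have "padic_abs p (X n) \<le> ?K" for n
  proof (cases "n \<le> N")
    case True
    then have "padic_abs p (X n) \<le> (\<Sum>k\<le>N. padic_abs p (X k))"
      by (intro member_le_sum) auto
    then show ?thesis by simp
  next
    case False
    have "padic_abs p (X N) \<le> (\<Sum>k\<le>N. padic_abs p (X k))"
      by (intro member_le_sum) auto
    moreover have "padic_abs p (X n - X N) < 1" using N False by auto
    ultimately show ?thesis using padic_abs_add_le[OF p, of "X n - X N" "X N"] by simp
  qed
  ultimately show ?thesis using that by blast
qed

lemma padic_Cauchy_add:
  assumes p: "prime p" and X: "padic_Cauchy p X" and Y: "padic_Cauchy p Y"
  shows "padic_Cauchy p (\<lambda>n. X n + Y n)"
  unfolding padic_Cauchy_def
proof (intro allI impI)
  fix e :: real assume e: "e > 0"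
  obtain M where M: "\<forall>m\<ge>M. \<forall>n\<ge>M. padic_abs p (X m - X n) < e"
    using X e unfolding padic_Cauchy_def by blast
  obtain N where N: "\<forall>m\<ge>N. \<forall>n\<ge>N. padic_abs p (Y m - Y n) < e"
    using Y e unfolding padic_Cauchy_def by blast
  have "padic_abs p (X m + Y m - (X n + Y n)) < e" if "m \<ge> max M N" "n \<ge> max M N" for m n
  proof -
    have "X m + Y m - (X n + Y n) = (X m - X n) + (Y m - Y n)" by simp
    then have "padic_abs p (X m + Y m - (X n + Y n))
        \<le> max (padic_abs p (X m - X n)) (padic_abs p (Y m - Y n))"
      using padic_abs_add[OF p] by metis
    also have "\<dots> < e" using M N that by auto
    finally show ?thesis .
  qed
  then show "\<exists>N. \<forall>m\<ge>N. \<forall>n\<ge>N. padic_abs p (X m + Y m - (X n + Y n)) < e" by blast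
qed

lemma padic_Cauchy_uminus: "padic_Cauchy p X \<Longrightarrow> padic_Cauchy p (\<lambda>n. - X n)"
  unfolding padic_Cauchy_def by (simp add: padic_abs_diff_commute)

lemma padic_Cauchy_mult:
  assumes p: "prime p" and X: "padic_Cauchy p X" and Y: "padic_Cauchy p Y"
  shows "padic_Cauchy p (\<lambda>n. X n * Y n)"
  unfolding padic_Cauchy_def
proof (intro allI impI)
  fix e :: real assume e: "e > 0"
  obtain K where K: "K > 0" "\<And>n. padic_abs p (X n) \<le> K"
    using padic_Cauchy_bounded[OF p X] by blast
  obtain L where L: "L > 0" "\<And>n. padic_abs p (Y n) \<le> L"
    using padic_Cauchy_bounded[OF p Y] by blast
  have "e / L > 0" "e / K > 0" using e K L by auto
  then obtain M N where M: "\<forall>m\<ge>M. \<forall>n\<ge>M. padic_abs p (X m - X n) < e / L"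
    and N: "\<forall>m\<ge>N. \<forall>n\<ge>N. padic_abs p (Y m - Y n) < e / K"
    using X Y unfolding padic_Cauchy_def by meson
  have "padic_abs p (X m * Y m - X n * Y n) < e" if "m \<ge> max M N" "n \<ge> max M N" for m n
  proof -
    have "X m * Y m - X n * Y n = X m * (Y m - Y n) + (X m - X n) * Y n"
      by (simp add: algebra_simps)
    then have "padic_abs p (X m * Y m - X n * Y n)
        \<le> max (padic_abs p (X m) * padic_abs p (Y m - Y n))
              (padic_abs p (X m - X n) * padic_abs p (Y n))"
      using padic_abs_add[OF p] padic_abs_mult[OF p] by metis
    moreover have "padic_abs p (X m) * padic_abs p (Y m - Y n) < e"
    proof -
      have "padic_abs p (X m) * padic_abs p (Y m - Y n) \<le> K * padic_abs p (Y m - Y n)"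
        using K by (intro mult_right_mono) auto
      also have "\<dots> < K * (e / K)" using N that K(1) by (intro mult_strict_left_mono) auto
      finally show ?thesis using K by simp
    qed
    moreover have "padic_abs p (X m - X n) * padic_abs p (Y n) < e"
    proof -
      have "padic_abs p (X m - X n) * padic_abs p (Y n) \<le> padic_abs p (X m - X n) * L"
        using L by (intro mult_left_mono) auto
      also have "\<dots> < e / L * L" using M that L(1) by (intro mult_strict_right_mono) auto
      finally show ?thesis using L by simp
    qed
    ultimately show ?thesis by linarith
  qed
  then show "\<exists>N. \<forall>m\<ge>N. \<forall>n\<ge>N. padic_abs p (X m * Y m - X n * Y n) < e" by blast
qed

lemma null_seq_comparison:
  fixes f g :: "nat \<Rightarrow> real"
  assumes "\<forall>\<^sub>F n in sequentially. norm (f n) \<le> g n" and "g \<longlonglongrightarrow> 0"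
  shows "f \<longlonglongrightarrow> 0"
  by (rule tendsto_0_le[OF assms(2), of _ 1])
    (use assms(1) in \<open>auto elim!: eventually_mono\<close>)

lemma padic_null_add:
  assumes p: "prime p" and X: "X \<in> padic_null p" and Y: "Y \<in> padic_null p"
  shows "(\<lambda>n. X n + Y n) \<in> padic_null p"
proof -
  have "(\<lambda>n. padic_abs p (X n) + padic_abs p (Y n)) \<longlonglongrightarrow> 0 + 0"
    using X Y by (intro tendsto_add) (auto simp: padic_null_def)
  then have "(\<lambda>n. padic_abs p (X n) + padic_abs p (Y n)) \<longlonglongrightarrow> 0" by simp
  then have "(\<lambda>n. padic_abs p (X n + Y n)) \<longlonglongrightarrow> 0"
    by (rule null_seq_comparison[rotated]) (simp add: padic_abs_add_le[OF p])
  then show ?thesis by (simp add: padic_null_def)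
qed

lemma padic_null_uminus: "X \<in> padic_null p \<Longrightarrow> (\<lambda>n. - X n) \<in> padic_null p"
  by (simp add: padic_null_def)

lemma padic_null_mult:
  assumes p: "prime p" and X: "X \<in> padic_null p" and Y: "padic_Cauchy p Y"
  shows "(\<lambda>n. Y n * X n) \<in> padic_null p"
proof -
  obtain L where L: "L > 0" "\<And>n. padic_abs p (Y n) \<le> L"
    using padic_Cauchy_bounded[OF p Y] by blast
  have "(\<lambda>n. L * padic_abs p (X n)) \<longlonglongrightarrow> L * 0"
    using X by (intro tendsto_mult) (auto simp: padic_null_def)
  then have "(\<lambda>n. L * padic_abs p (X n)) \<longlonglongrightarrow> 0" by simp
  then have "(\<lambda>n. padic_abs p (Y n * X n)) \<longlonglongrightarrow> 0"
    by (rule null_seq_comparison[rotated])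
      (simp add: padic_abs_mult[OF p] L mult_right_mono)
  then show ?thesis by (simp add: padic_null_def)
qed

lemma padic_null_Cauchy:
  assumes p: "prime p" and X: "X \<in> padic_null p"
  shows "padic_Cauchy p X"
  unfolding padic_Cauchy_def
proof (intro allI impI)
  fix e :: real assume e: "e > 0"
  obtain N where N: "\<forall>n\<ge>N. padic_abs p (X n) < e"
    using X e unfolding padic_null_def LIMSEQ_def by (auto simp: dist_real_def)
  have "padic_abs p (X m - X n) < e" if "m \<ge> N" "n \<ge> N" for m n
  proof -
    have "padic_abs p (X m) < e" "padic_abs p (X n) < e" using N that by auto
    then show ?thesis using padic_abs_add[OF p, of "X m" "- X n"] by simp
  qed
  then show "\<exists>N. \<forall>m\<ge>N. \<forall>n\<ge>N. padic_abs p (X m - X n) < e" by blast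
qed

lemma cring_padic_Cauchy_ring:
  assumes p: "prime p"
  shows "cring (padic_Cauchy_ring p)"
proof (rule cringI)
  show "abelian_group (padic_Cauchy_ring p)"
  proof (rule abelian_groupI)
    fix X assume "X \<in> carrier (padic_Cauchy_ring p)"
    then show "\<exists>Y\<in>carrier (padic_Cauchy_ring p). Y \<oplus>\<^bsub>padic_Cauchy_ring p\<^esub> X = \<zero>\<^bsub>padic_Cauchy_ring p\<^esub>"
      by (intro bexI[of _ "\<lambda>n. - X n"]) (auto simp: padic_Cauchy_ring_def padic_Cauchy_uminus)
  qed (auto simp: padic_Cauchy_ring_def padic_Cauchy_add p add_ac)
  show "comm_monoid (padic_Cauchy_ring p)"
    by (rule comm_monoidI) (auto simp: padic_Cauchy_ring_def padic_Cauchy_mult p mult_ac)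
qed (auto simp: padic_Cauchy_ring_def algebra_simps)

lemma a_inv_padic_Cauchy_ring:
  assumes p: "prime p" and X: "padic_Cauchy p X"
  shows "\<ominus>\<^bsub>padic_Cauchy_ring p\<^esub> X = (\<lambda>n. - X n)"
proof -
  interpret cring "padic_Cauchy_ring p" by (rule cring_padic_Cauchy_ring[OF p])
  show ?thesis
    by (rule minus_equality)
      (use X in \<open>auto simp: padic_Cauchy_ring_def padic_Cauchy_uminus\<close>)
qed

lemma ideal_padic_null:
  assumes p: "prime p"
  shows "ideal (padic_null p) (padic_Cauchy_ring p)"
proof -
  interpret cring "padic_Cauchy_ring p" by (rule cring_padic_Cauchy_ring[OF p])
  show ?thesis
  proof (rule idealI)
    show "ring (padic_Cauchy_ring p)" by (rule ring_axioms)
    show "subgroup (padic_null p) (add_monoid (padic_Cauchy_ring p))"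
    proof (rule add.subgroupI)
      show "padic_null p \<subseteq> carrier (padic_Cauchy_ring p)"
        using padic_null_Cauchy[OF p] by (auto simp: padic_Cauchy_ring_def)
      have "(\<lambda>n. 0) \<in> padic_null p" by (simp add: padic_null_def)
      then show "padic_null p \<noteq> {}" by blast
      show "\<ominus>\<^bsub>padic_Cauchy_ring p\<^esub> X \<in> padic_null p" if "X \<in> padic_null p" for X
        using that padic_null_uminus
        by (simp add: a_inv_padic_Cauchy_ring[OF p padic_null_Cauchy[OF p]])
    qed (auto simp: padic_Cauchy_ring_def padic_null_add[OF p])
  qed (use padic_null_mult[OF p] in \<open>auto simp: padic_Cauchy_ring_def mult.commute\<close>)
qed

lemma padic_Cauchy_nonnull_bounded_below:
  assumes p: "prime p" and X: "padic_Cauchy p X" and nX: "X \<notin> padic_null p"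
  obtains c N where "c > 0" "\<And>n. n \<ge> N \<Longrightarrow> padic_abs p (X n) \<ge> c"
proof -
  obtain e where e: "e > 0" and inf: "\<And>N. \<exists>n\<ge>N. padic_abs p (X n) \<ge> e"
    using nX unfolding padic_null_def LIMSEQ_def by (auto simp: dist_real_def not_less)
  obtain N where N: "\<forall>m\<ge>N. \<forall>n\<ge>N. padic_abs p (X m - X n) < e / 2"
    using X e unfolding padic_Cauchy_def by (meson half_gt_zero)
  obtain m where m: "m \<ge> N" "padic_abs p (X m) \<ge> e" using inf by blast
  have "padic_abs p (X n) \<ge> e / 2" if n: "n \<ge> N" for n
  proof -
    have "padic_abs p (X m - X n) < e / 2" using N m(1) n by blast
    then show ?thesis using padic_abs_add_le[OF p, of "X m - X n" "X n"] m(2) by simp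
  qed
  with e show ?thesis using that[of "e / 2" N] by simp
qed

lemma padic_Cauchy_inverse:
  assumes p: "prime p" and X: "padic_Cauchy p X" and nX: "X \<notin> padic_null p"
  shows "padic_Cauchy p (\<lambda>n. inverse (X n))"
    and "(\<lambda>n. 1 - inverse (X n) * X n) \<in> padic_null p"
proof -
  obtain c K where c: "c > 0" "\<And>n. n \<ge> K \<Longrightarrow> padic_abs p (X n) \<ge> c"
    using padic_Cauchy_nonnull_bounded_below[OF p X nX] by blast
  have nz: "X n \<noteq> 0" if "n \<ge> K" for n using c(2)[OF that] c(1) by auto
  show "padic_Cauchy p (\<lambda>n. inverse (X n))"
    unfolding padic_Cauchy_def
  proof (intro allI impI)
    fix e :: real assume e: "e > 0"
    then have "e * (c * c) > 0" using c by simp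
    then obtain N where N: "\<forall>m\<ge>N. \<forall>n\<ge>N. padic_abs p (X m - X n) < e * (c * c)"
      using X unfolding padic_Cauchy_def by blast
    have "padic_abs p (inverse (X m) - inverse (X n)) < e" if mn: "m \<ge> max N K" "n \<ge> max N K" for m n
    proof -
      let ?d = "padic_abs p (inverse (X m) - inverse (X n))"
      have "X m - X n = - ((inverse (X m) - inverse (X n)) * (X m * X n))"
        using nz mn by (simp add: field_simps)
      then have "padic_abs p (X m - X n) = ?d * (padic_abs p (X m) * padic_abs p (X n))"
        by (metis padic_abs_uminus padic_abs_mult[OF p])
      moreover have "?d * (c * c) \<le> ?d * (padic_abs p (X m) * padic_abs p (X n))"
        using c mn by (intro mult_left_mono mult_mono) auto
      moreover have "padic_abs p (X m - X n) < e * (c * c)" using N mn by simp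
      ultimately have "?d * (c * c) < e * (c * c)" by linarith
      then show ?thesis using c(1) by (simp add: mult_less_cancel_right)
    qed
    then show "\<exists>N. \<forall>m\<ge>N. \<forall>n\<ge>N. padic_abs p (inverse (X m) - inverse (X n)) < e" by blast
  qed
  have "eventually (\<lambda>n. padic_abs p (1 - inverse (X n) * X n) = 0) sequentially"
    by (rule eventually_sequentiallyI[of K]) (simp add: nz)
  then show "(\<lambda>n. 1 - inverse (X n) * X n) \<in> padic_null p"
    unfolding padic_null_def by (simp add: tendsto_eventually)
qed

theorem field_Qp:
  assumes p: "prime p"
  shows "field (Qp p)"
proof -
  let ?R = "padic_Cauchy_ring p"
  interpret R: cring ?R by (rule cring_padic_Cauchy_ring[OF p])
  have "maximalideal (padic_null p) ?R"
  proof (rule maximalidealI)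
    show "ideal (padic_null p) ?R" by (rule ideal_padic_null[OF p])
    have "(\<lambda>n. 1) \<in> carrier ?R" "(\<lambda>n. 1) \<notin> padic_null p"
      by (auto simp: padic_Cauchy_ring_def padic_null_def LIMSEQ_const_iff)
    then show "carrier ?R \<noteq> padic_null p" by blast
    fix J assume J: "ideal J ?R" and sub: "padic_null p \<subseteq> J" "J \<subseteq> carrier ?R"
    interpret J: ideal J ?R by (rule J)
    show "J = padic_null p \<or> J = carrier ?R"
    proof (cases "J = padic_null p")
      case False
      then obtain X where X: "X \<in> J" "X \<notin> padic_null p" using sub by blast
      then have CX: "padic_Cauchy p X" using sub by (auto simp: padic_Cauchy_ring_def)
      note inv = padic_Cauchy_inverse[OF p CX X(2)]
      have "(\<lambda>n. inverse (X n)) \<otimes>\<^bsub>?R\<^esub> X \<in> J"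
        using J.I_l_closed[OF X(1)] inv(1) by (simp add: padic_Cauchy_ring_def)
      moreover have "(\<lambda>n. 1 - inverse (X n) * X n) \<in> J" using inv(2) sub by blast
      ultimately have "(\<lambda>n. 1 - inverse (X n) * X n) \<oplus>\<^bsub>?R\<^esub> ((\<lambda>n. inverse (X n)) \<otimes>\<^bsub>?R\<^esub> X) \<in> J"
        by (intro J.a_closed)
      then have "\<one>\<^bsub>?R\<^esub> \<in> J" by (simp add: padic_Cauchy_ring_def)
      then show ?thesis using J.one_imp_carrier by blast
    qed simp
  qed
  then show ?thesis
    unfolding Qp_def by (rule maximalideal.quotient_is_field[OF _ R.is_cring])
qed

lemma Qp_of_rat_hom:
  assumes p: "prime p"
  shows "Qp_of_rat p q \<in> carrier (Qp p)"
    and "Qp_of_rat p (q + r) = Qp_of_rat p q \<oplus>\<^bsub>Qp p\<^esub> Qp_of_rat p r"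
    and "Qp_of_rat p (q * r) = Qp_of_rat p q \<otimes>\<^bsub>Qp p\<^esub> Qp_of_rat p r"
    and "Qp_of_rat p 1 = \<one>\<^bsub>Qp p\<^esub>"
proof -
  interpret I: ideal "padic_null p" "padic_Cauchy_ring p" by (rule ideal_padic_null[OF p])
  note hom = I.rcos_ring_hom
  have c: "(\<lambda>n. a) \<in> carrier (padic_Cauchy_ring p)" for a
    by (simp add: padic_Cauchy_ring_def)
  show "Qp_of_rat p q \<in> carrier (Qp p)"
    unfolding Qp_def Qp_of_rat_def by (rule ring_hom_closed[OF hom c])
  show "Qp_of_rat p (q + r) = Qp_of_rat p q \<oplus>\<^bsub>Qp p\<^esub> Qp_of_rat p r"
    using ring_hom_add[OF hom c c, of q r] unfolding Qp_def Qp_of_rat_def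
    by (simp add: padic_Cauchy_ring_def)
  show "Qp_of_rat p (q * r) = Qp_of_rat p q \<otimes>\<^bsub>Qp p\<^esub> Qp_of_rat p r"
    using ring_hom_mult[OF hom c c, of q r] unfolding Qp_def Qp_of_rat_def
    by (simp add: padic_Cauchy_ring_def)
  show "Qp_of_rat p 1 = \<one>\<^bsub>Qp p\<^esub>"
    using ring_hom_one[OF hom] unfolding Qp_def Qp_of_rat_def
    by (simp add: padic_Cauchy_ring_def)
qed

lemma Qp_abs_class:
  assumes p: "prime p" and X: "padic_Cauchy p X"
  shows "(\<lambda>n. padic_abs p (X n)) \<longlonglongrightarrow> Qp_abs p (padic_null p +>\<^bsub>padic_Cauchy_ring p\<^esub> X)"
proof -
  let ?x = "padic_null p +>\<^bsub>padic_Cauchy_ring p\<^esub> X"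
  interpret I: ideal "padic_null p" "padic_Cauchy_ring p" by (rule ideal_padic_null[OF p])
  have "X \<in> ?x"
    using X by (intro I.a_rcos_self) (simp add: padic_Cauchy_ring_def)
  then have "(SOME Y. Y \<in> ?x) \<in> ?x" by (rule someI[where P = "\<lambda>Y. Y \<in> ?x"])
  then obtain Z where Z: "Z \<in> padic_null p" "(SOME Y. Y \<in> ?x) = (\<lambda>n. Z n + X n)"
    by (auto simp: a_r_coset_def' padic_Cauchy_ring_def)
  have "Cauchy (\<lambda>n. padic_abs p (X n))"
  proof (rule CauchyI')
    fix e :: real assume "e > 0"
    then obtain N where N: "\<forall>m\<ge>N. \<forall>n\<ge>N. padic_abs p (X m - X n) < e"
      using X unfolding padic_Cauchy_def by blast
    have "norm (padic_abs p (X m) - padic_abs p (X n)) < e" if "m \<ge> N" "n > m" for m n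
    proof -
      have "padic_abs p (X m - X n) < e" using N that by simp
      then show ?thesis using padic_abs_diff_ge[OF p, of "X m" "X n"] by simp
    qed
    then show "\<exists>M. \<forall>m\<ge>M. \<forall>n>m. dist (padic_abs p (X m)) (padic_abs p (X n)) < e"
      by (auto simp: dist_norm)
  qed
  then obtain L where L: "(\<lambda>n. padic_abs p (X n)) \<longlonglongrightarrow> L"
    by (meson Cauchy_convergent convergentD)
  have "(\<lambda>n. padic_abs p (Z n + X n) - padic_abs p (X n)) \<longlonglongrightarrow> 0"
  proof (rule null_seq_comparison)
    show "\<forall>\<^sub>F n in sequentially. norm (padic_abs p (Z n + X n) - padic_abs p (X n)) \<le> padic_abs p (Z n)"
      using padic_abs_diff_ge[OF p] by (metis (mono_tags, lifting) add_diff_cancel_right' always_eventually real_norm_def)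
    show "(\<lambda>n. padic_abs p (Z n)) \<longlonglongrightarrow> 0" using Z by (simp add: padic_null_def)
  qed
  from tendsto_add[OF this L] have "(\<lambda>n. padic_abs p (Z n + X n)) \<longlonglongrightarrow> L" by simp
  then have "Qp_abs p ?x = L" unfolding Qp_abs_def Z(2) by (rule limI)
  with L show ?thesis by simp
qed

lemma Qp_abs_of_rat: "prime p \<Longrightarrow> Qp_abs p (Qp_of_rat p q) = padic_abs p q"
  using Qp_abs_class[of p "\<lambda>n. q"] by (simp add: Qp_of_rat_def LIMSEQ_const_iff)

end

theory Submission
  imports Defs "HOL-Number_Theory.Residues"
begin

text \<open>
  Comparing coefficients of \<open>X\<^sup>p\<close> in \<open>X / (e\<^sup>X - 1) \<cdot> (e\<^sup>2\<^sup>X - 1) = X (e\<^sup>X + 1)\<close> and dividing by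
  \<open>p \<cdot> 2\<^sup>p\<close> gives
  \<open>1/p + \<Sum> (p-1 choose k-1) B\<^sub>k / (k 2\<^sup>k) = 1/2\<^sup>p\<close>, the sum ranging over \<open>1 \<le> k \<le> p-1\<close>.
  Adding the sum of the theorem, the terms \<open>1/p\<close> and \<open>-1/p\<close> cancel and \<open>B\<^sub>k / (k 2\<^sup>k)\<close> gets the factor
  \<open>1 + (p-1 choose k-1)\<close>, where \<open>(p-1 choose k-1) \<equiv> (-1)\<^sup>k\<^sup>-\<^sup>1\<close> modulo \<open>p\<close>. So the terms with
  \<open>2 \<le> k \<le> p-2\<close> drop out modulo \<open>p\<close>: for odd \<open>k\<close> since \<open>B\<^sub>k = 0\<close>, for even \<open>k\<close> since the factor is
  divisible by \<open>p\<close> and \<open>B\<^sub>k\<close> is \<open>p\<close>-integral. What remains is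
  \<open>-1/2\<^sup>p - 1/2 + p B\<^sub>p\<^sub>-\<^sub>1 / ((p-1) 2\<^sup>p\<^sup>-\<^sup>1)\<close>, which vanishes modulo \<open>p\<close> because
  \<open>2\<^sup>p\<^sup>-\<^sup>1 \<equiv> 1\<close> and \<open>p B\<^sub>p\<^sub>-\<^sub>1 \<equiv> -1\<close>.
\<close>

section \<open>Bernoulli identities and a binomial congruence\<close>

text \<open>Substituting -X in b = X / (e^X - 1) gives b(-X) = b + X, so every coefficient of odd
  index other than 1 equals its own negative.\<close>

lemma bernoulli_odd_eq_0:
  assumes "odd n" "n \<noteq> 1"
  shows "bernoulli n = 0"
proof -
  define b :: "rat fps" where "b = fps_X / (fps_exp 1 - 1)"
  define b' where "b' = b oo - fps_X"
  define E :: "rat fps" where "E = fps_exp 1"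
  have E: "E oo - fps_X = fps_exp (-1)"
    by (simp add: E_def fps_compose_uminus' fps_eq_iff)
  have EE: "fps_exp (-1) * E = 1"
    using fps_exp_add_mult[of "-1" "1::rat"] by (simp add: E_def)
  have bE: "b * (E - 1) = fps_X"
    unfolding b_def E_def by (rule fps_X_eq_bernoulli)
  have "b' * (fps_exp (-1) - 1) = (b * (E - 1)) oo - fps_X"
    by (simp add: fps_compose_mult_distrib fps_compose_sub_distrib b'_def E)
  also have "\<dots> = - fps_X"
    unfolding bE by (simp add: fps_compose_uminus' fps_eq_iff)
  finally have *: "b' * (fps_exp (-1) - 1) = - fps_X" .
  have "b' * (E - 1) = - (b' * (fps_exp (-1) * E - E))"
    unfolding EE by (simp add: algebra_simps)
  also have "\<dots> = - (b' * (fps_exp (-1) - 1)) * E"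
    by (simp add: algebra_simps)
  also have "\<dots> = fps_X * E"
    unfolding * by simp
  finally have "b' * (E - 1) = fps_X * E" .
  also have "\<dots> = fps_X * (E - 1) + b * (E - 1)"
    unfolding bE by (simp add: algebra_simps)
  finally have "b' * (E - 1) = (b + fps_X) * (E - 1)"
    by (simp add: algebra_simps)
  moreover have "E - 1 \<noteq> 0" using bE by auto
  ultimately have "b' = b + fps_X" by simp
  then have "fps_nth b' n = fps_nth (b + fps_X) n" by simp
  then have "fps_nth b n = 0"
    using assms by (simp add: b'_def fps_compose_uminus')
  then show ?thesis by (simp add: bernoulli_def b_def)
qed

lemma sum_bernoulli_two_power:
  assumes "n \<ge> 2"
  shows "(\<Sum>k<n. of_nat (n choose k) * bernoulli k * 2 ^ (n - k)) = of_nat n"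
proof -
  let ?b = "fps_X / (fps_exp 1 - 1) :: rat fps"
  have "?b * (fps_exp 2 - 1) = ?b * (fps_exp 1 - 1) * (fps_exp 1 + 1)"
    using fps_exp_add_mult[of 1 "1::rat"] by (simp add: algebra_simps)
  also have "\<dots> = fps_X * (fps_exp 1 + 1)"
    unfolding fps_X_eq_bernoulli ..
  finally have "fact n * fps_nth (?b * (fps_exp 2 - 1)) n = fact n * fps_nth (fps_X * (fps_exp 1 + 1)) n"
    by simp
  \<comment> \<open>For n >= 2 only e^X contributes, with n! / (n - 1)!; the summand 1 affects only
    the coefficient of X.\<close>
  also have "\<dots> = of_nat n"
    using assms by (cases n) auto
  also have "fps_nth (?b * (fps_exp 2 - 1)) n = (\<Sum>k=0..n. fps_nth ?b k * fps_nth (fps_exp 2 - 1) (n - k))"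
    by (rule fps_mult_nth)
  \<comment> \<open>The term k = n drops out because \<open>fps_exp 2 - 1\<close> has constant term
    0.\<close>
  also have "\<dots> = (\<Sum>k<n. fps_nth ?b k * (2 ^ (n - k) / fact (n - k)))"
    by (rule sum.mono_neutral_cong_right) auto
  also have "fact n * \<dots> = (\<Sum>k<n. of_nat (n choose k) * bernoulli k * 2 ^ (n - k))"
    unfolding sum_distrib_left
    by (intro sum.cong refl) (simp add: bernoulli_def binomial_fact)
  finally show ?thesis .
qed

text \<open>By Pascal's rule, neighbours in row p - 1 add up to an inner entry of row p, which p
  divides; so the residue only changes sign at each step.\<close>

lemma prime_dvd_choose_pred:
  assumes p: "prime p" and "j < p"
  shows "int p dvd int (p - 1 choose j) - (-1) ^ j"
  using \<open>j < p\<close>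
proof (induction j)
  case (Suc j)
  have "p choose Suc j = (p - 1 choose j) + (p - 1 choose Suc j)"
    using Suc.prems by (cases p) auto
  moreover have "p dvd p choose Suc j"
    by (rule dvd_choose_prime) (use p Suc.prems in auto)
  ultimately have "int p dvd int (p - 1 choose j) + int (p - 1 choose Suc j)"
    by (metis of_nat_add of_nat_dvd_iff)
  moreover have "int p dvd int (p - 1 choose j) - (-1) ^ j" using Suc by simp
  ultimately have "int p dvd int (p - 1 choose j) + int (p - 1 choose Suc j)
      - (int (p - 1 choose j) - (-1) ^ j)" by (rule dvd_diff)
  then show ?case by simp
qed simp

section \<open>Rationals that are integral at p\<close>

text \<open>This is the localization of the integers at p. A congruence x = 0 modulo p is expressed
  below as \<open>p_integral p (x / of_nat p)\<close>.\<close>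

definition p_integral :: "nat \<Rightarrow> rat \<Rightarrow> bool" where
  "p_integral p x \<longleftrightarrow> padic_abs p x \<le> 1"

lemma p_integral_add: "prime p \<Longrightarrow> p_integral p x \<Longrightarrow> p_integral p y \<Longrightarrow> p_integral p (x + y)"
  unfolding p_integral_def using padic_abs_add[of p x y] by linarith

lemma p_integral_uminus: "p_integral p (- x) \<longleftrightarrow> p_integral p x"
  by (simp add: p_integral_def)

lemma p_integral_diff: "prime p \<Longrightarrow> p_integral p x \<Longrightarrow> p_integral p y \<Longrightarrow> p_integral p (x - y)"
  using p_integral_add[of p x "- y"] by (simp add: p_integral_uminus)

lemma p_integral_mult: "prime p \<Longrightarrow> p_integral p x \<Longrightarrow> p_integral p y \<Longrightarrow> p_integral p (x * y)"
  unfolding p_integral_def by (simp add: padic_abs_mult mult_le_one)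

lemma p_integral_0: "p_integral p 0"
  by (simp add: p_integral_def)

lemma p_integral_sum:
  assumes "prime p" "\<And>k. k \<in> A \<Longrightarrow> p_integral p (f k)"
  shows "p_integral p (\<Sum>k\<in>A. f k)"
  using assms(2)
  by (induction A rule: infinite_finite_induct)
    (simp_all add: p_integral_add[OF assms(1)] p_integral_0)

lemma p_integral_of_int:
  assumes "prime p"
  shows "p_integral p (of_int a)"
proof (cases "a = 0")
  case False
  then have "padic_val p (of_int a) \<ge> 0"
    using padic_val_divide[OF assms, of a 1] by simp
  then show ?thesis
    using False assms prime_ge_1_nat[OF assms]
    by (simp add: p_integral_def padic_abs_def power_int_minus field_simps)
qed (simp add: p_integral_def)

text \<open>Integers prime to p have absolute value 1, hence are units among the p-integral
  rationals.\<close>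

lemma p_integral_divide:
  assumes "prime p" "\<not> int p dvd a" "p_integral p x"
  shows "p_integral p (x / of_int a)"
proof -
  have a: "a \<noteq> 0" using assms(2) by auto
  then have "padic_val p (of_int a) = 0"
    using padic_val_divide[OF assms(1), of a 1] assms(2) by (simp add: not_dvd_imp_multiplicity_0)
  then have "padic_abs p (of_int a) = 1" using a by (simp add: padic_abs_def)
  moreover have "padic_abs p x = padic_abs p (x / of_int a) * padic_abs p (of_int a)"
    using a padic_abs_mult[OF assms(1), of "x / of_int a" "of_int a"] by simp
  ultimately show ?thesis using assms(3) by (simp add: p_integral_def)
qed

section \<open>Bernoulli numbers at p\<close>

text \<open>Solving the recurrence for the last term divides only by n + 1, which is smaller than
  p.\<close>

lemma p_integral_bernoulli:
  assumes p: "prime p" and "Suc n < p"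
  shows "p_integral p (bernoulli n)"
  using \<open>Suc n < p\<close>
proof (induction n rule: less_induct)
  case (less n)
  have "(\<Sum>k<n. of_nat (Suc n choose k) * bernoulli k) + of_nat (Suc n) * bernoulli n
      = (if n = 0 then 1 else 0)"
    using bernoulli_recurrence[of n]
    by (simp only: lessThan_Suc_atMost[symmetric] sum.lessThan_Suc) simp
  then have "bernoulli n = (of_int (if n = 0 then 1 else 0)
      - (\<Sum>k<n. of_int (int (Suc n choose k)) * bernoulli k)) / of_int (int (Suc n))"
    by (simp add: field_simps del: binomial_Suc_Suc split: if_splits)
  also have "p_integral p \<dots>"
  proof (intro p_integral_divide p_integral_diff p_integral_of_int p_integral_sum p_integral_mult p)
    show "\<not> int p dvd int (Suc n)"
      using less.prems by (auto simp del: of_nat_Suc dest: dvd_imp_le)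
  qed (use less in auto)
  finally show ?case .
qed

text \<open>The von Staudt-Clausen statement for index p - 1. In the recurrence divided by p, the
  ends k = 0 and k = p - 1 give the two terms, and every other binomial is divisible by p.\<close>

lemma p_integral_bernoulli_pred:
  assumes p: "prime p" "odd p"
  shows "p_integral p (bernoulli (p - 1) + 1 / of_nat p)"
proof -
  obtain m where "p = 2 + m" using prime_ge_2_nat[OF p(1)] le_Suc_ex by blast
  then have m: "p = Suc (Suc m)" by simp
  then have m0: "m \<noteq> 0" using p(2) by (cases "m = 0") auto
  define f where "f k = of_nat (p choose k) * bernoulli k / of_nat p" for k
  have "(\<Sum>k\<le>Suc m. of_nat (p choose k) * bernoulli k) = 0"
    using bernoulli_recurrence[of "Suc m"] m0 by (simp add: m del: binomial_Suc_Suc sum.atMost_Suc)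
  then have "(\<Sum>k\<le>Suc m. f k) = 0"
    unfolding f_def sum_divide_distrib[symmetric] by simp
  also have "(\<Sum>k\<le>Suc m. f k) = f 0 + (\<Sum>k=1..m. f k) + f (Suc m)"
  proof -
    have "{..Suc m} = insert 0 (insert (Suc m) {1..m})" by auto
    then show ?thesis by simp
  qed
  also have "f 0 = 1 / of_nat p" by (simp add: f_def bernoulli_0)
  also have "f (Suc m) = bernoulli (Suc m)"
    by (simp add: f_def m del: binomial_Suc_Suc)
  finally have "bernoulli (p - 1) + 1 / of_nat p = - (\<Sum>k=1..m. f k)"
    by (simp add: m algebra_simps eq_neg_iff_add_eq_0)
  also have "p_integral p \<dots>"
    unfolding p_integral_uminus
  proof (intro p_integral_sum p(1))
    fix k assume k: "k \<in> {1..m}"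
    then have "p dvd p choose k"
      by (intro dvd_choose_prime) (use p m in auto)
    then obtain c where c: "p choose k = p * c" ..
    have "f k = of_int (int c) * bernoulli k"
      using p by (simp add: f_def c)
    also have "p_integral p \<dots>"
      by (intro p_integral_mult p_integral_of_int p_integral_bernoulli p(1)) (use k m in auto)
    finally show "p_integral p (f k)" .
  qed
  finally show ?thesis .
qed

section \<open>The congruence over the rationals\<close>

lemma p_integral_bernoulli_sum:
  assumes p: "prime p" "odd p"
  shows "p_integral p ((- 1 / of_nat p + (\<Sum>k=1..p - 1. bernoulli k / of_nat k / 2 ^ k)) / of_nat p)"
proof -
  define P :: rat where "P = of_nat p"
  define t :: rat where "t = 2 ^ (p - 1)"
  define S where "S = - 1 / P + (\<Sum>k=1..p - 1. bernoulli k / of_nat k / 2 ^ k)"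
  define g where "g k = of_nat (1 + (p - 1 choose (k - 1))) * (bernoulli k / of_nat k / 2 ^ k)" for k
  define v where "v = bernoulli (p - 1) + 1 / P"
  define W where "W = (\<Sum>k=2..p - 2. g k)"
  have p3: "p \<ge> 3" using prime_ge_2_nat[OF p(1)] p(2) by (cases "p = 2") auto
  then have P: "P \<noteq> 0" "P - 1 \<noteq> 0" and t: "t \<noteq> 0" by (auto simp: P_def t_def)
  have p2: "\<not> p dvd 2" using p3 by (auto dest: dvd_imp_le)
  have tp: "2 ^ p = 2 * t" using p3 by (cases p) (auto simp: t_def)

  have "P = (\<Sum>k<p. of_nat (p choose k) * bernoulli k * 2 ^ (p - k))"
    using sum_bernoulli_two_power[of p] p3 by (simp add: P_def)
  also have "{..<p} = insert 0 {1..p - 1}" using p3 by auto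
  also have "(\<Sum>k\<in>\<dots>. of_nat (p choose k) * bernoulli k * 2 ^ (p - k))
      = 2 ^ p + (\<Sum>k=1..p - 1. of_nat (p choose k) * bernoulli k * 2 ^ (p - k))"
    by (simp add: bernoulli_0)
  \<comment> \<open>Absorption: k (p choose k) = p (p - 1 choose k - 1).\<close>
  also have "(\<Sum>k=1..p - 1. of_nat (p choose k) * bernoulli k * 2 ^ (p - k))
      = P * 2 ^ p * (\<Sum>k=1..p - 1. of_nat (p - 1 choose (k - 1)) * (bernoulli k / of_nat k / 2 ^ k))"
    unfolding sum_distrib_left
  proof (intro sum.cong refl)
    fix k assume k: "k \<in> {1..p - 1}"
    then have "k * (p choose k) = p * (p - 1 choose (k - 1))"
      using times_binomial_minus1_eq[of k p] by simp
    then have "of_nat k * of_nat (p choose k) = P * of_nat (p - 1 choose (k - 1))"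
      unfolding P_def by (metis of_nat_mult)
    then have "of_nat (p choose k) = P * of_nat (p - 1 choose (k - 1)) / of_nat k"
      using k by (simp add: field_simps)
    moreover have "(2::rat) ^ (p - k) = 2 ^ p / 2 ^ k"
      using k by (intro power_diff) auto
    ultimately show "of_nat (p choose k) * bernoulli k * 2 ^ (p - k)
        = P * 2 ^ p * (of_nat (p - 1 choose (k - 1)) * (bernoulli k / of_nat k / 2 ^ k))"
      by simp
  qed
  finally have "1 / P + (\<Sum>k=1..p - 1. of_nat (p - 1 choose (k - 1)) * (bernoulli k / of_nat k / 2 ^ k))
      = 1 / 2 ^ p"
    using P by (simp add: field_simps)
  then have "S + 1 / 2 ^ p = (\<Sum>k=1..p - 1. g k)"
    unfolding S_def g_def of_nat_add of_nat_1 distrib_right sum.distrib by simp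
  also have "{1..p - 1} = insert 1 (insert (p - 1) {2..p - 2})" using p3 by auto
  also have "(\<Sum>k\<in>\<dots>. g k) = g 1 + g (p - 1) + W"
  proof -
    have "1 \<notin> insert (p - 1) {2..p - 2}" "p - 1 \<notin> {2..p - 2}" using p3 by auto
    then show ?thesis by (simp add: W_def del: One_nat_def)
  qed
  also have "g 1 = - 1 / 2" using bernoulli_1 by (simp add: g_def)
  \<comment> \<open>The factor 1 + (p - 1 choose p - 2) is p, which compensates the p in the
    denominator of B_(p-1).\<close>
  also have "g (p - 1) = P * bernoulli (p - 1) / (P - 1) / t"
    using p3 binomial_symmetric[of "p - 2" "p - 1"]
    by (simp add: g_def t_def P_def numeral_2_eq_2 Suc_diff_Suc)
  finally have S: "S = W - 1 / (2 * t) - 1 / 2 + P * bernoulli (p - 1) / (P - 1) / t"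
    by (simp add: tp)

  have "p_integral p (W / P)"
    unfolding W_def sum_divide_distrib
  proof (intro p_integral_sum p(1))
    fix k assume k: "k \<in> {2..p - 2}"
    show "p_integral p (g k / P)"
    proof (cases "even k")
      case True
      \<comment> \<open>The sign (-1)^(k-1) is -1 here, so p divides the factor 1 + (p - 1 choose k
        - 1).\<close>
      then have "odd (k - 1)" "k - 1 < p" using k by auto
      then have "int p dvd int (1 + (p - 1 choose (k - 1)))"
        using prime_dvd_choose_pred[OF p(1), of "k - 1"] by (simp add: add.commute)
      then obtain c where c: "int (1 + (p - 1 choose (k - 1))) = int p * c" ..
      have "(of_nat (1 + (p - 1 choose (k - 1))) :: rat) = of_int (int (1 + (p - 1 choose (k - 1))))"
        by simp
      also have "\<dots> = P * of_int c" unfolding c by (simp add: P_def)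
      finally have "g k / P = of_int c * (bernoulli k / of_int (int k) / of_int (2 ^ k))"
        using P unfolding g_def by simp
      also have "p_integral p \<dots>"
      proof (intro p_integral_mult p_integral_divide p_integral_of_int p_integral_bernoulli p(1))
        show "\<not> int p dvd int k" using k by (auto dest: dvd_imp_le)
        show "\<not> int p dvd 2 ^ k"
          using p p2 by (metis of_nat_dvd_iff of_nat_numeral prime_dvd_power prime_nat_int_transfer)
      qed (use k in auto)
      finally show ?thesis .
    next
      case False
      then show ?thesis
        using bernoulli_odd_eq_0[of k] k by (simp add: g_def p_integral_def)
    qed
  qed
  moreover have "p_integral p ((S - W) / P)"
  proof -
    have "[2 ^ (p - 1) = 1] (mod p)" by (rule fermat_theorem[OF p(1) p2])
    then have "int p dvd 2 ^ (p - 1) - 1"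
      by (metis cong_iff_dvd_diff cong_int_iff of_nat_1 of_nat_numeral of_nat_power)
    then obtain q where q: "2 ^ (p - 1) - 1 = int p * q" ..
    have "t - 1 = of_int (2 ^ (p - 1) - 1)" by (simp add: t_def)
    also have "\<dots> = P * of_int q" unfolding q by (simp add: P_def)
    finally have tq: "t = 1 + P * of_int q" by (simp add: algebra_simps)
    have v: "bernoulli (p - 1) = v - 1 / P" by (simp add: v_def)
    have "S - W = ((P - 1) * (- 1 - t) + 2 * (P * v - 1)) / (2 * (P - 1) * t)"
      unfolding S v using P t by (simp add: divide_simps) (simp add: algebra_simps)
    \<comment> \<open>With t = 1 + P q the constants 2 and -2 cancel, so P can be factored
      out.\<close>
    also have "(P - 1) * (- 1 - t) + 2 * (P * v - 1) = P * (2 * v - 2 - (P - 1) * of_int q)"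
      unfolding tq by (simp add: algebra_simps)
    finally have "(S - W) / P = (2 * v - 2 - (P - 1) * of_int q) / (2 * (P - 1) * t)"
      using P by simp
    \<comment> \<open>Integers are collected under \<open>of_int\<close> so that
      \<open>p_integral_divide\<close> applies to the denominator.\<close>
    also have "\<dots> = (of_int 2 * v - of_int (2 + (int p - 1) * q)) / of_int (2 * (int p - 1) * 2 ^ (p - 1))"
      by (simp add: P_def t_def diff_diff_eq)
    also have "p_integral p \<dots>"
    proof (intro p_integral_mult p_integral_divide p_integral_diff p_integral_of_int p(1))
      show "p_integral p v"
        unfolding v_def P_def by (rule p_integral_bernoulli_pred[OF p])
      have pe: "prime (int p)" using p by simp
      have "\<not> int p dvd int p - 1" using p3 by (auto dest: zdvd_imp_le)
      moreover have "\<not> int p dvd 2" using p2 by (metis of_nat_dvd_iff of_nat_numeral)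
      ultimately show "\<not> int p dvd 2 * (int p - 1) * 2 ^ (p - 1)"
        using pe prime_dvd_power[OF pe] by (metis prime_dvd_mult_iff)
    qed
    finally show ?thesis .
  qed
  ultimately have "p_integral p (W / P + (S - W) / P)" by (rule p_integral_add[OF p(1)])
  also have "W / P + (S - W) / P = S / P" by (simp add: diff_divide_distrib)
  finally show ?thesis by (simp add: S_def P_def)
qed

section \<open>Transfer to the p-adic numbers\<close>

lemma Qp_of_rat_inv_power:
  assumes p: "prime p" and q: "q \<noteq> 0"
  shows "inv\<^bsub>Qp p\<^esub> (Qp_of_rat p q [^]\<^bsub>Qp p\<^esub> (k::nat)) = Qp_of_rat p (1 / q ^ k)"
proof -
  interpret field "Qp p" by (rule field_Qp[OF p])
  note hom = Qp_of_rat_hom[OF p]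
  have pow: "Qp_of_rat p q [^]\<^bsub>Qp p\<^esub> k = Qp_of_rat p (q ^ k)"
    by (induction k) (simp_all add: hom m_comm)
  have "Qp_of_rat p (q ^ k) \<otimes>\<^bsub>Qp p\<^esub> Qp_of_rat p (1 / q ^ k) = \<one>\<^bsub>Qp p\<^esub>"
    using q by (simp add: hom(3)[symmetric] hom(4))
  then show ?thesis
    unfolding pow by (intro comm_inv_char hom)
qed

lemma Qp_of_rat_0: "prime p \<Longrightarrow> Qp_of_rat p 0 = \<zero>\<^bsub>Qp p\<^esub>"
proof -
  assume p: "prime p"
  interpret field "Qp p" by (rule field_Qp[OF p])
  show ?thesis
    \<comment> \<open>The image x of 0 satisfies x = x + x.\<close>
    using Qp_of_rat_hom(2)[OF p, of 0 0] Qp_of_rat_hom(1)[OF p, of 0] by simp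
qed

lemma Qp_of_rat_sum:
  assumes p: "prime p" and "finite A"
  shows "Qp_of_rat p (\<Sum>k\<in>A. f k) = (\<Oplus>\<^bsub>Qp p\<^esub>k\<in>A. Qp_of_rat p (f k))"
proof -
  interpret field "Qp p" by (rule field_Qp[OF p])
  show ?thesis
    using \<open>finite A\<close>
    by (induction A) (simp_all add: Qp_of_rat_0[OF p] Qp_of_rat_hom[OF p] Pi_def)
qed

text \<open>The cofactor of p is the image of q / p, whose p-adic absolute value is that of the
  rational.\<close>

lemma Qp_of_rat_in_p_Zp:
  assumes p: "prime p" and "p_integral p (q / of_nat p)"
  shows "Qp_of_rat p q \<in> p_Zp p"
proof -
  have "Qp_of_rat p q = Qp_of_rat p (of_nat p) \<otimes>\<^bsub>Qp p\<^esub> Qp_of_rat p (q / of_nat p)"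
    using p by (simp add: Qp_of_rat_hom(3)[OF p, symmetric])
  moreover have "Qp_of_rat p (q / of_nat p) \<in> Zp p"
    using assms by (simp add: Zp_def Qp_of_rat_hom Qp_abs_of_rat p_integral_def)
  ultimately show ?thesis unfolding p_Zp_def by blast
qed

theorem theorem5:
  fixes p :: nat
  assumes "prime p" and "odd p"
  shows "(\<Oplus>\<^bsub>Qp p\<^esub>k\<in>{0..p - 1}.
            bernoulli_Qp p k \<otimes>\<^bsub>Qp p\<^esub> inv\<^bsub>Qp p\<^esub> (Qp_of_rat p 2 [^]\<^bsub>Qp p\<^esub> k)) \<in> p_Zp p"
proof -
  let ?f = "\<lambda>k. (if k = 0 then - 1 / of_nat p else bernoulli k / of_nat k) / 2 ^ k"
  have "bernoulli_Qp p k \<otimes>\<^bsub>Qp p\<^esub> inv\<^bsub>Qp p\<^esub> (Qp_of_rat p 2 [^]\<^bsub>Qp p\<^esub> k) = Qp_of_rat p (?f k)" for k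
    using Qp_of_rat_hom(3)[OF assms(1), of _ "1 / 2 ^ k"]
    by (simp add: Qp_of_rat_inv_power[OF assms(1)] bernoulli_Qp_def flip: Qp_of_rat_hom(3)[OF assms(1)])
  then have "(\<Oplus>\<^bsub>Qp p\<^esub>k\<in>{0..p - 1}.
      bernoulli_Qp p k \<otimes>\<^bsub>Qp p\<^esub> inv\<^bsub>Qp p\<^esub> (Qp_of_rat p 2 [^]\<^bsub>Qp p\<^esub> k)) = Qp_of_rat p (\<Sum>k=0..p - 1. ?f k)"
    by (simp only: Qp_of_rat_sum[OF assms(1)] finite_atLeastAtMost)
  \<comment> \<open>Splitting off k = 0 isolates the exceptional value -1/p, where 2^0 = 1.\<close>
  also have "(\<Sum>k=0..p - 1. ?f k) = - 1 / of_nat p + (\<Sum>k=1..p - 1. bernoulli k / of_nat k / 2 ^ k)"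
    by (simp add: sum.atLeast_Suc_atMost)
  also have "Qp_of_rat p \<dots> \<in> p_Zp p"
    by (intro Qp_of_rat_in_p_Zp p_integral_bernoulli_sum assms)
  finally show ?thesis .
qed

end
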